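(* The radius of parabolic starlikeness for $\mathcal{T}_1$ and for $\mathcal{T}_2$ is respectively equal to its radius of starlikeness of order $1/2$, i.e. $R_{\mathcal{S}^*_p}(\mathcal{T}_i)=R_{\mathcal{S}^*(1/2)}(\mathcal{T}_i)$ for $i=1,2$. Thus (i) $R_{\mathcal{S}^*_p}(\mathcal{T}_1)=1/4$; (ii) $R_{\mathcal{S}^*_p}(\mathcal{T}_2)=1/6$.
   Context: $\mathbb{D}=\{z\in\mathbb{C}:|z|<1\}$; $\mathcal{A}$ is the class of analytic functions $f$ on $\mathbb{D}$ with $f(0)=0$, $f'(0)=1$. For analytic $F,G$ on $\mathbb{D}$, $F\prec G$ (subordination) means $F(z)=G(w(z))$ on $\mathbb{D}$ for some analytic $w:\mathbb{D}\to\mathbb{D}$ with $|w(z)|\le|z|$. Quotients such as $f(z)/g(z)$, $g(z)/(zp(z))$, $zf'(z)/f(z)$ are understood as analytic functions on $\mathbb{D}$ with the removable singularity at $0$ filled in (value of $zf'(z)/f(z)$ at $0$ is $1$). $\sqrt{1+z}$ is the principal branch. $\mathcal{T}_1$ is the class of $f\in\mathcal{A}$ for which there exist $g\in\mathcal{A}$ and an analytic $p$ on $\mathbb{D}$ with $f(z)/g(z)\prec\sqrt{1+z}$, $g(z)/(zp(z))\prec\sqrt{1+z}$, $p(z)\prec\sqrt{1+z}$. $\mathcal{T}_2$ is the class of $f\in\mathcal{A}$ for which there exist $g\in\mathcal{A}$ and an analytic $p$ on $\mathbb{D}$ with $f(z)/g(z)\prec e^z$, $g(z)/(zp(z))\prec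 e^z$, $p(z)\prec e^z$. For $\mathcal{G},\mathcal{M}\subset\mathcal{A}$, the $\mathcal{G}$-radius $R_{\mathcal{G}}(\mathcal{M})$ is the largest number $R$ such that the function $z\mapsto r^{-1}f(rz)$ belongs to $\mathcal{G}$ for every $0<r\le R$ and every $f\in\mathcal{M}$. $\mathcal{S}^*(1/2)$ (starlike of order $1/2$) is the class of $f\in\mathcal{A}$ with $\operatorname{Re}(zf'(z)/f(z))>1/2$ on $\mathbb{D}$. $\mathcal{S}^*_p$ (parabolic starlike functions) is the class of $f\in\mathcal{A}$ with $\operatorname{Re}\left(\frac{zf'(z)}{f(z)}\right)>\left|\frac{zf'(z)}{f(z)}-1\right|$ for all $z\in\mathbb{D}$; equivalently $zf'(z)/f(z)\prec 1+\frac{2}{\pi^2}\left(\log\frac{1+\sqrt z}{1-\sqrt z}\right)^2$, $\operatorname{Im}\sqrt z\ge0$. *)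

theory Defs
  imports "HOL-Complex_Analysis.Complex_Analysis"
begin

text \<open>
  A function on the open unit disc is represented by a total function on the complex
  plane; its values off the disc are never used.  Quotients of analytic functions are
  taken through \<^const>\<open>remove_sings\<close>, which replaces the value at each point by the
  limit there.  It gives 0 at a pole.
\<close>

abbreviation unit_disc :: "complex set" where
  "unit_disc \<equiv> ball 0 1"

definition class_A :: "(complex \<Rightarrow> complex) set" where
  "class_A = {f. f holomorphic_on unit_disc \<and> f 0 = 0 \<and> deriv f 0 = 1}"

definition subordinate :: "(complex \<Rightarrow> complex) \<Rightarrow> (complex \<Rightarrow> complex) \<Rightarrow> bool"
    (infix \<open>\<prec>\<^sub>s\<close> 50) where
  "F \<prec>\<^sub>s G \<longleftrightarrow>
     F holomorphic_on unit_disc \<and> G holomorphic_on unit_disc \<and>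
     (\<exists>w. w holomorphic_on unit_disc \<and> w ` unit_disc \<subseteq> unit_disc \<and>
          (\<forall>z\<in>unit_disc. norm (w z) \<le> norm z) \<and>
          (\<forall>z\<in>unit_disc. F z = G (w z)))"

definition class_T :: "(complex \<Rightarrow> complex) \<Rightarrow> (complex \<Rightarrow> complex) set" where
  "class_T \<phi> =
     {f \<in> class_A. \<exists>g\<in>class_A. \<exists>p. p holomorphic_on unit_disc \<and>
        remove_sings (\<lambda>z. f z / g z) \<prec>\<^sub>s \<phi> \<and>
        remove_sings (\<lambda>z. g z / (z * p z)) \<prec>\<^sub>s \<phi> \<and>
        p \<prec>\<^sub>s \<phi>}"

definition T1 :: "(complex \<Rightarrow> complex) set" where
  "T1 = class_T (\<lambda>z. csqrt (1 + z))"

definition T2 :: "(complex \<Rightarrow> complex) set" where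
  "T2 = class_T exp"

text \<open>
  For \<open>f\<close> in \<^const>\<open>class_A\<close> the following function is 1 at 0, and it has a pole, hence
  the value 0, at any other zero of \<open>f\<close> in the disc.  The inequalities defining the two
  classes below fail for the value 0, so their members vanish only at the origin.
\<close>

definition starlike_quotient :: "(complex \<Rightarrow> complex) \<Rightarrow> complex \<Rightarrow> complex" where
  "starlike_quotient f = remove_sings (\<lambda>z. z * deriv f z / f z)"

definition starlike_half :: "(complex \<Rightarrow> complex) set" where
  "starlike_half = {f \<in> class_A. \<forall>z\<in>unit_disc. Re (starlike_quotient f z) > 1 / 2}"

definition parabolic_starlike :: "(complex \<Rightarrow> complex) set" where
  "parabolic_starlike =
     {f \<in> class_A. \<forall>z\<in>unit_disc.
        Re (starlike_quotient f z) > norm (starlike_quotient f z - 1)}"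

text \<open>
  Only \<open>R \<le> 1\<close> is considered, because for \<open>r > 1\<close> the function \<open>z \<mapsto> f (r z) / r\<close> is not
  defined on the whole disc.
\<close>

definition admissible_radius ::
    "(complex \<Rightarrow> complex) set \<Rightarrow> (complex \<Rightarrow> complex) set \<Rightarrow> real \<Rightarrow> bool" where
  "admissible_radius G M R \<longleftrightarrow>
     0 \<le> R \<and> R \<le> 1 \<and>
     (\<forall>r. 0 < r \<and> r \<le> R \<longrightarrow>
        (\<forall>f\<in>M. (\<lambda>z. f (of_real r * z) / of_real r) \<in> G))"

text \<open>
  The radius is a relation, not a function, so that an assertion about it includes
  that a largest admissible number exists.
\<close>

definition is_radius ::
    "(complex \<Rightarrow> complex) set \<Rightarrow> (complex \<Rightarrow> complex) set \<Rightarrow> real \<Rightarrow> bool" where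
  "is_radius G M R \<longleftrightarrow>
     admissible_radius G M R \<and> (\<forall>R'. admissible_radius G M R' \<longrightarrow> R' \<le> R)"

end

theory Submission imports Defs begin

text \<open>
  Both generating functions have the form \<open>exp \<circ> L\<close> on the disc: \<open>L z = Ln (1 + z) / 2\<close> gives
  the square root and \<open>L z = z\<close> the exponential.  If \<open>f\<close> belongs to the class generated by
  \<open>exp \<circ> L\<close>, the three subordinations multiply to
  \<open>f z = z * exp (L (u z) + L (v z) + L (w z))\<close> with holomorphic \<open>u\<close>, \<open>v\<close>, \<open>w\<close> bounded in modulus by
  \<open>\<bar>z\<bar>\<close>, so that \<open>z f'/f - 1\<close> is the sum of the three terms \<open>z (L \<circ> u)'\<close>, \<open>z (L \<circ> v)'\<close>,
  \<open>z (L \<circ> w)'\<close>.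

  The whole problem is therefore to bound one such term.  Writing \<open>w z = z h z\<close> and applying
  the Schwarz-Pick inequality to \<open>h\<close> gives, with \<open>r = \<bar>z\<bar>\<close>, the bound \<open>r / (2 (1 - r))\<close> in the
  square root case, and \<open>r\<close> for small \<open>r\<close> in the exponential case.  Each bound is below
  \<open>1/6\<close> exactly when \<open>r < 1/4\<close>, respectively \<open>r < 1/6\<close>.  Below that radius
  \<open>\<bar>z f'/f - 1\<bar> < 1/2\<close>, a disc contained both in the half-plane \<open>Re q > 1/2\<close> and in the parabolic
  region \<open>Re q > \<bar>q - 1\<bar>\<close>.  The point \<open>1/2\<close> lies on the boundary of both regions, and
  \<open>f z = z * exp (3 * L z)\<close> attains it at minus the radius.  Hence the two radii agree.
\<close>

section \<open>The Schwarz-Pick inequality and Schwarz functions\<close>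

text \<open>
  Disc automorphisms carry \<open>a\<close> and \<open>h a\<close> to the origin, where the Schwarz lemma bounds the
  derivative by 1; the chain rule turns this into the stated inequality.
\<close>

lemma Schwarz_Pick_deriv_disc:
  fixes h :: "complex \<Rightarrow> complex"
  assumes holh: "h holomorphic_on ball 0 1"
    and h1: "\<And>z. norm z < 1 \<Longrightarrow> norm (h z) < 1"
    and a: "norm a < 1"
  shows "norm (deriv h a) * (1 - (norm a)\<^sup>2) \<le> 1 - (norm (h a))\<^sup>2"
proof -
  let ?M = "\<lambda>c z::complex. (z - c) / (1 - cnj c * z)"
  have M_eq: "Moebius_function 0 c = ?M c" for c
    by (auto simp: Moebius_function_simple)
  have M_lt: "norm (?M c z) < 1" if "norm c < 1" "norm z < 1" for c z
    using Moebius_function_norm_lt_1[OF that, of 0] by (simp add: M_eq)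
  have M_hol: "?M c holomorphic_on ball 0 1" if "norm c < 1" for c
    using Moebius_function_holomorphic[OF that, of 0] by (simp add: M_eq)
  define b where "b = h a"
  have b: "norm b < 1" using h1 a by (simp add: b_def)
  define g where "g = (\<lambda>z. ?M b (h (?M (- a) z)))"
  have sq: "1 - cnj c * c = of_real (1 - (norm c)\<^sup>2)" for c
    unfolding of_real_diff complex_norm_square by (simp add: mult.commute)
  have pos: "1 - (norm c)\<^sup>2 > 0" if "norm c < 1" for c :: complex
    using that by (simp add: power_less_one_iff abs_square_less_1)
  have nz: "1 - cnj b * b \<noteq> 0"
    using pos[OF b] unfolding sq by (metis less_irrefl of_real_eq_0_iff)
  have hol1: "(h \<circ> ?M (- a)) holomorphic_on ball 0 1"
  proof (rule holomorphic_on_compose_gen[OF M_hol holh])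
    show "?M (- a) ` ball 0 1 \<subseteq> ball 0 1" using M_lt[of "- a"] a by auto
  qed (use a in auto)
  have "(?M b \<circ> (h \<circ> ?M (- a))) holomorphic_on ball 0 1"
  proof (rule holomorphic_on_compose_gen[OF hol1 M_hol[OF b]])
    show "(h \<circ> ?M (- a)) ` ball 0 1 \<subseteq> ball 0 1" using M_lt[of "- a"] a h1 by auto
  qed
  then have holg: "g holomorphic_on ball 0 1" by (simp add: g_def o_def)
  have g1: "norm (g z) < 1" if "norm z < 1" for z
    unfolding g_def using M_lt[of "- a" z] a that by (intro M_lt b h1) auto
  have dg: "norm (deriv g 0) \<le> 1"
    using Schwarz_Lemma(2)[OF holg _ g1, of 0] by (auto simp: g_def b_def)
  have "(?M (- a) has_field_derivative 1 - cnj a * a) (at 0)"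
    by (rule derivative_eq_intros refl | simp add: mult.commute)+
  then have d1: "(?M (- a) has_field_derivative of_real (1 - (norm a)\<^sup>2)) (at 0)"
    by (simp only: sq)
  have d2: "(h has_field_derivative deriv h a) (at (?M (- a) 0))"
    using holomorphic_derivI[OF holh, of a] a by simp
  have "(?M b has_field_derivative inverse (1 - cnj b * b)) (at b)"
    by (rule derivative_eq_intros refl nz | simp add: nz inverse_eq_divide)+
  then have d3: "(?M b has_field_derivative inverse (1 - cnj b * b)) (at (h (?M (- a) 0)))"
    by (simp add: b_def)
  have "(g has_field_derivative
      inverse (1 - cnj b * b) * (deriv h a * of_real (1 - (norm a)\<^sup>2))) (at 0)"
    unfolding g_def by (rule DERIV_chain2[OF d3 DERIV_chain2[OF d2 d1]])
  then have "deriv g 0 = inverse (of_real (1 - (norm b)\<^sup>2)) * (deriv h a * of_real (1 - (norm a)\<^sup>2))"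
    unfolding sq by (rule DERIV_imp_deriv)
  then have "norm (deriv g 0)
      = inverse \<bar>1 - (norm b)\<^sup>2\<bar> * (norm (deriv h a) * \<bar>1 - (norm a)\<^sup>2\<bar>)"
    by (simp only: norm_mult norm_inverse norm_of_real)
  then have "norm (deriv g 0) = norm (deriv h a) * (1 - (norm a)\<^sup>2) / (1 - (norm b)\<^sup>2)"
    using pos[OF a] pos[OF b] by (simp add: field_simps)
  then show ?thesis using dg pos[OF b] by (simp add: b_def divide_le_eq)
qed

text \<open>
  The factor of a Schwarz function may be a unimodular constant (a rotation), so the closed
  disc has to be allowed as target.  By the maximum modulus principle that is the only new case.
\<close>

lemma Schwarz_Pick_deriv:
  fixes h :: "complex \<Rightarrow> complex"
  assumes holh: "h holomorphic_on ball 0 1"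
    and h1: "\<And>z. norm z < 1 \<Longrightarrow> norm (h z) \<le> 1"
    and a: "norm a < 1"
  shows "norm (deriv h a) * (1 - (norm a)\<^sup>2) \<le> 1 - (norm (h a))\<^sup>2"
proof (cases "\<forall>z. norm z < 1 \<longrightarrow> norm (h z) < 1")
  case True
  then show ?thesis using Schwarz_Pick_deriv_disc[OF holh _ a] by blast
next
  case False
  then obtain c where c: "norm c < 1" "norm (h c) = 1" using h1 by force
  have "h constant_on ball 0 1"
  proof (rule Schwarz2[OF holh, of "1 - norm c" c])
    show sub: "ball c (1 - norm c) \<subseteq> ball 0 1"
      using c norm_triangle_sub[of _ c] by (auto simp: dist_norm norm_minus_commute) (smt (verit))
    show "norm (h z) \<le> norm (h c)" if "norm (c - z) < 1 - norm c" for z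
      using that sub c h1[of z] by (auto simp: dist_norm subset_iff)
  qed (use c in auto)
  then obtain k where k: "\<And>z. z \<in> ball 0 1 \<Longrightarrow> h z = k" by (auto simp: constant_on_def)
  have "deriv h a = deriv (\<lambda>_. k) a"
    by (rule deriv_cong_ev) (use a k eventually_nhds_in_open[of "ball 0 1" a] in \<open>auto elim: eventually_mono\<close>)
  then show ?thesis using h1[OF a] by (simp add: abs_square_le_1)
qed

text \<open>
  The condition \<open>\<bar>w z\<bar> \<le> \<bar>z\<bar>\<close> already implies \<open>w 0 = 0\<close> and that \<open>w\<close> maps the disc into itself,
  so these are exactly the functions that occur in a subordination.
\<close>

definition schwarz_function :: "(complex \<Rightarrow> complex) \<Rightarrow> bool" where
  "schwarz_function w \<longleftrightarrow>
     w holomorphic_on unit_disc \<and> (\<forall>z\<in>unit_disc. norm (w z) \<le> norm z)"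

lemma schwarz_functionD:
  assumes "schwarz_function w"
  shows "w holomorphic_on unit_disc" "w 0 = 0"
    "\<And>z. norm z < 1 \<Longrightarrow> norm (w z) \<le> norm z"
    "\<And>z. norm z < 1 \<Longrightarrow> norm (w z) < 1"
proof -
  show hol: "w holomorphic_on unit_disc"
    and le: "\<And>z. norm z < 1 \<Longrightarrow> norm (w z) \<le> norm z"
    using assms by (auto simp: schwarz_function_def)
  show "w 0 = 0" using le[of 0] by simp
  show "norm (w z) < 1" if "norm z < 1" for z using le[OF that] that by simp
qed

text \<open>
  Here \<open>t\<close> is the modulus of \<open>h z\<close> in the factorization \<open>w z = z * h z\<close>.  The bound is
  the triangle inequality for \<open>z w' = z h + z\<^sup>2 h'\<close> with the Schwarz-Pick inequality for \<open>h'\<close>.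
\<close>

lemma schwarz_function_deriv_bound:
  assumes w: "schwarz_function w" and z: "norm z < 1"
  obtains t where "0 \<le> t" "t \<le> 1" "norm (w z) = norm z * t"
    "norm (z * deriv w z) \<le> norm z * t + (norm z)\<^sup>2 * (1 - t\<^sup>2) / (1 - (norm z)\<^sup>2)"
proof -
  obtain h where holh: "h holomorphic_on ball 0 1"
    and wh: "\<And>z. norm z < 1 \<Longrightarrow> w z = z * h z" and d0: "deriv w 0 = h 0"
    using Schwarz3[OF schwarz_functionD(1,2)[OF w]] by blast
  have h1: "norm (h x) \<le> 1" if "norm x < 1" for x
  proof (cases "x = 0")
    case True
    then show ?thesis
      using Schwarz_Lemma(2)[OF schwarz_functionD(1,2,4)[OF w], of 0] d0 by simp
  next
    case False
    then show ?thesis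
      using schwarz_functionD(3)[OF w that] wh[OF that] by (simp add: norm_mult)
  qed
  have "(h has_field_derivative deriv h z) (at z)"
    using holomorphic_derivI[OF holh] z by simp
  then have "((\<lambda>z. z * h z) has_field_derivative h z + z * deriv h z) (at z)"
    by (auto intro!: derivative_eq_intros)
  then have "(w has_field_derivative h z + z * deriv h z) (at z)"
    by (rule has_field_derivative_transform_within_open[of _ _ _ "ball 0 1"]) (use z wh in auto)
  then have "z * deriv w z = z * h z + z\<^sup>2 * deriv h z"
    by (simp add: DERIV_imp_deriv algebra_simps power2_eq_square)
  then have 1: "norm (z * deriv w z) \<le> norm z * norm (h z) + (norm z)\<^sup>2 * norm (deriv h z)"
    by (metis norm_triangle_ineq norm_mult norm_power)
  have pos: "1 - (norm z)\<^sup>2 > 0" using z by (simp add: abs_square_less_1)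
  have "norm (deriv h z) \<le> (1 - (norm (h z))\<^sup>2) / (1 - (norm z)\<^sup>2)"
    using Schwarz_Pick_deriv[OF holh h1 z] pos by (simp add: le_divide_eq)
  then have "(norm z)\<^sup>2 * norm (deriv h z) \<le> (norm z)\<^sup>2 * (1 - (norm (h z))\<^sup>2) / (1 - (norm z)\<^sup>2)"
    by (metis mult_left_mono times_divide_eq_right zero_le_power2)
  with 1 show ?thesis
    by (intro that[of "norm (h z)"]) (use h1[OF z] wh[OF z] in \<open>auto simp: norm_mult\<close>)
qed

text \<open>
  Dieudonne's lemma.  The hypothesis says that \<open>\<bar>z\<bar>\<close> is at most the square root of 2 minus 1:
  there the right-hand side of the preceding bound is largest at \<open>t = 1\<close>, that is, for rotations.
\<close>

lemma schwarz_function_deriv_le: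
  assumes w: "schwarz_function w" and z: "norm z < 1" and dieu: "2 * norm z \<le> 1 - (norm z)\<^sup>2"
  shows "norm (z * deriv w z) \<le> norm z"
proof -
  define r where "r = norm z"
  obtain t where t: "0 \<le> t" "t \<le> 1"
    and b: "norm (z * deriv w z) \<le> r * t + r\<^sup>2 * (1 - t\<^sup>2) / (1 - r\<^sup>2)"
    using schwarz_function_deriv_bound[OF w z] unfolding r_def by metis
  have r: "0 \<le> r" "r < 1" "2 * r \<le> 1 - r\<^sup>2" using z dieu by (auto simp: r_def)
  have pos: "1 - r\<^sup>2 > 0" using r by (simp add: abs_square_less_1)
  have "r * (1 + t) \<le> 1 - r\<^sup>2" using r t mult_left_mono[of t 1 r] by (simp add: algebra_simps)
  then have "r * (1 - t) * (r * (1 + t)) \<le> r * (1 - t) * (1 - r\<^sup>2)"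
    using r t by (intro mult_left_mono) auto
  then have "r\<^sup>2 * (1 - t\<^sup>2) \<le> r * (1 - t) * (1 - r\<^sup>2)"
    by (simp add: power2_eq_square algebra_simps)
  then have "r\<^sup>2 * (1 - t\<^sup>2) / (1 - r\<^sup>2) \<le> r * (1 - t)"
    using pos by (simp add: divide_le_eq)
  with b show ?thesis by (simp add: r_def algebra_simps)
qed

text \<open>
  Dividing by \<open>1 + w\<close>, of modulus at least \<open>1 - r t\<close>, makes \<open>t = 1\<close> the worst
  case on the whole disc: once denominators and a factor \<open>1 - t\<close> are cleared, this is \<open>r (1 + t) \<le> 1 + r\<close>.
\<close>

lemma schwarz_function_log_deriv_le:
  assumes w: "schwarz_function w" and z: "norm z < 1"
  shows "norm (z * deriv w z / (1 + w z)) \<le> norm z / (1 - norm z)"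
proof -
  define r where "r = norm z"
  obtain t where t: "0 \<le> t" "t \<le> 1" "norm (w z) = r * t"
    and b: "norm (z * deriv w z) \<le> r * t + r\<^sup>2 * (1 - t\<^sup>2) / (1 - r\<^sup>2)"
    using schwarz_function_deriv_bound[OF w z] unfolding r_def by metis
  have r: "0 \<le> r" "r < 1" using z by (auto simp: r_def)
  have pos: "1 - r\<^sup>2 > 0" using r by (simp add: abs_square_less_1)
  have rt: "r * t < 1" using r t mult_left_le[of t r] by linarith
  have "r * (1 - t) * (r * (1 + t)) \<le> r * (1 - t) * (1 + r)"
    using r t mult_left_le[of t r] by (intro mult_left_mono) (auto simp: algebra_simps)
  then have "r\<^sup>2 * (1 - t\<^sup>2) \<le> r * (1 - t) * (1 + r)"
    by (simp add: power2_eq_square algebra_simps)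
  then have "r\<^sup>2 * (1 - t\<^sup>2) / (1 - r\<^sup>2) \<le> r * (1 - t) * (1 + r) / (1 - r\<^sup>2)"
    using pos by (simp add: divide_right_mono)
  also have "\<dots> = r * (1 - t) / (1 - r)"
    using r pos by (simp add: frac_eq_eq power2_eq_square algebra_simps)
  finally have "norm (z * deriv w z) \<le> r * t + r * (1 - t) / (1 - r)"
    using b by linarith
  also have "\<dots> = r / (1 - r) * (1 - r * t)"
    using r by (simp add: field_simps)
  also have "\<dots> \<le> r / (1 - r) * norm (1 + w z)"
  proof (rule mult_left_mono)
    have "1 - norm (w z) \<le> norm (1 + w z)"
      using norm_diff_ineq[of 1 "w z"] by simp
    then show "1 - r * t \<le> norm (1 + w z)" using t by simp
  qed (use r in simp)
  finally have "norm (z * deriv w z) \<le> r / (1 - r) * norm (1 + w z)" .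
  moreover have "norm (1 + w z) > 0"
    using schwarz_functionD(4)[OF w z] by (metis add.inverse_unique less_irrefl norm_minus_cancel norm_one zero_less_norm_iff)
  ultimately show ?thesis by (simp add: norm_divide divide_le_eq r_def)
qed

section \<open>Removable singularities and logarithmic derivatives\<close>

text \<open>
  All quotients below are only ambiguous at the origin, so their continuation is identified by
  a formula valid elsewhere.
\<close>

lemma remove_sings_eq_holomorphic:
  assumes "k holomorphic_on S" "open S" "z \<in> S"
    and eq: "\<And>x. x \<in> S \<Longrightarrow> x \<noteq> 0 \<Longrightarrow> u x = k x"
  shows "remove_sings u z = k z"
proof (rule remove_sings_eqI)
  have "eventually (\<lambda>x. x \<in> S \<and> x \<noteq> 0) (at z)"
  proof (cases "z = 0")
    case True
    then show ?thesis
      using eventually_at_in_open[OF assms(2,3)] by (auto elim: eventually_mono)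
  next
    case False
    then have "eventually (\<lambda>x. x \<in> S - {0}) (at z)"
      using assms by (intro eventually_at_in_open') auto
    then show ?thesis by (auto elim: eventually_mono)
  qed
  then have "eventually (\<lambda>x. k x = u x) (at z)"
    by eventually_elim (use eq in auto)
  moreover have "k \<midarrow>z\<rightarrow> k z"
    using assms by (metis continuous_on_eq_continuous_at holomorphic_on_imp_continuous_on isCont_def)
  ultimately show "u \<midarrow>z\<rightarrow> k z" by (rule Lim_transform_eventually[rotated])
qed

lemma holomorphic_on_disc_if_DERIV:
  assumes "\<And>z. z \<in> unit_disc \<Longrightarrow> (f has_field_derivative d z) (at z)"
  shows "f holomorphic_on unit_disc"
  using assms by (subst holomorphic_on_open) (blast intro: open_ball)+

lemma has_derivative_z_exp:
  assumes k: "k holomorphic_on unit_disc" and z: "z \<in> unit_disc"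
    and f: "\<And>z. z \<in> unit_disc \<Longrightarrow> f z = z * exp (k z)"
  shows "(f has_field_derivative exp (k z) * (1 + z * deriv k z)) (at z)"
proof -
  have "(k has_field_derivative deriv k z) (at z)"
    using holomorphic_derivI[OF k _ z] by simp
  then have "((\<lambda>z. z * exp (k z)) has_field_derivative exp (k z) * (1 + z * deriv k z)) (at z)"
    by (auto intro!: derivative_eq_intros simp: algebra_simps)
  then show ?thesis
    by (rule has_field_derivative_transform_within_open[of _ _ _ unit_disc]) (use z f in auto)
qed

lemma class_A_z_exp:
  assumes k: "k holomorphic_on unit_disc" "k 0 = 0"
    and f: "\<And>z. z \<in> unit_disc \<Longrightarrow> f z = z * exp (k z)"
  shows "f \<in> class_A"
proof -
  have "f holomorphic_on unit_disc"
    using has_derivative_z_exp[OF k(1) _ f] by (rule holomorphic_on_disc_if_DERIV)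
  moreover have "deriv f 0 = 1"
    using DERIV_imp_deriv[OF has_derivative_z_exp[OF k(1) _ f]] k(2) by simp
  ultimately show ?thesis using f[of 0] by (simp add: class_A_def)
qed

lemma starlike_quotient_z_exp:
  assumes k: "k holomorphic_on unit_disc" and z: "z \<in> unit_disc"
    and f: "\<And>z. z \<in> unit_disc \<Longrightarrow> f z = z * exp (k z)"
  shows "starlike_quotient f z = 1 + z * deriv k z"
  unfolding starlike_quotient_def
proof (rule remove_sings_eq_holomorphic[where S = unit_disc])
  show "(\<lambda>z. 1 + z * deriv k z) holomorphic_on unit_disc"
    by (intro holomorphic_intros k) auto
  show "x * deriv f x / f x = 1 + x * deriv k x" if "x \<in> unit_disc" "x \<noteq> 0" for x
    using that f[OF that(1)] DERIV_imp_deriv[OF has_derivative_z_exp[OF k that(1) f]] by simp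
qed (use z in auto)

text \<open>
  Dilating \<open>z * exp (k z)\<close> by \<open>r\<close> replaces \<open>k\<close> by \<open>k (r z)\<close>, so the starlike quotient of the
  dilation at \<open>z\<close> is that of the original function at \<open>r z\<close>.
\<close>

lemma dilation_z_exp:
  assumes k: "k holomorphic_on unit_disc" "k 0 = 0" and r: "0 < r" "r \<le> 1"
    and f: "\<And>z. z \<in> unit_disc \<Longrightarrow> f z = z * exp (k z)"
  defines "F \<equiv> \<lambda>z. f (of_real r * z) / of_real r"
  shows "F \<in> class_A"
    and "z \<in> unit_disc \<Longrightarrow> starlike_quotient F z = 1 + of_real r * z * deriv k (of_real r * z)"
proof -
  define m where "m = (\<lambda>z. k (of_real r * z))"
  have in_disc: "of_real r * z \<in> unit_disc" if "z \<in> unit_disc" for z :: complex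
    using that r mult_left_le_one_le[of "norm z" r] by (simp add: norm_mult)
  have dm: "(m has_field_derivative of_real r * deriv k (of_real r * z)) (at z)"
    if "z \<in> unit_disc" for z
  proof -
    have "(k has_field_derivative deriv k (of_real r * z)) (at (of_real r * z))"
      using holomorphic_derivI[OF k(1) _ in_disc[OF that]] by simp
    moreover have "((\<lambda>z. of_real r * z) has_field_derivative of_real r) (at z)"
      by (auto intro!: derivative_eq_intros)
    ultimately show ?thesis
      unfolding m_def by (subst mult.commute) (rule DERIV_chain2)
  qed
  have m: "m holomorphic_on unit_disc" "m 0 = 0"
    using holomorphic_on_disc_if_DERIV[OF dm] k(2) by (simp_all add: m_def)
  have F: "F z = z * exp (m z)" if "z \<in> unit_disc" for z
    using f[OF in_disc[OF that]] r by (simp add: F_def m_def)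
  show "F \<in> class_A" by (rule class_A_z_exp[OF m F])
  show "starlike_quotient F z = 1 + of_real r * z * deriv k (of_real r * z)" if "z \<in> unit_disc"
    using starlike_quotient_z_exp[OF m(1) that F] DERIV_imp_deriv[OF dm[OF that]] by simp
qed

section \<open>The radius for a nonvanishing subordinating function\<close>

text \<open>
  A logarithm \<open>L\<close> of the generating function turns the product of the three subordinate factors
  into a sum, whose terms can be estimated separately.
\<close>

locale exponential_generator =
  fixes \<phi> L :: "complex \<Rightarrow> complex"
  assumes holL: "L holomorphic_on unit_disc" and L0: "L 0 = 0"
    and phi: "\<And>z. z \<in> unit_disc \<Longrightarrow> \<phi> z = exp (L z)"
begin

lemma hol_phi: "\<phi> holomorphic_on unit_disc"
  by (rule holomorphic_transform[of "\<lambda>z. exp (L z)"]) (auto intro!: holomorphic_intros holL simp: phi)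

lemma L_comp:
  assumes "schwarz_function w"
  shows "(\<lambda>z. L (w z)) holomorphic_on unit_disc"
    and "z \<in> unit_disc \<Longrightarrow> ((\<lambda>z. L (w z)) has_field_derivative deriv L (w z) * deriv w z) (at z)"
proof -
  show d: "((\<lambda>z. L (w z)) has_field_derivative deriv L (w z) * deriv w z) (at z)"
    if "z \<in> unit_disc" for z
    using that schwarz_functionD[OF assms]
    by (intro DERIV_chain2[of L] holomorphic_derivI[OF holL] holomorphic_derivI[of w unit_disc]) auto
  then show "(\<lambda>z. L (w z)) holomorphic_on unit_disc"
    by (rule holomorphic_on_disc_if_DERIV)
qed

lemma subordinate_phiE:
  assumes "F \<prec>\<^sub>s \<phi>"
  obtains w where "schwarz_function w" "\<And>z. z \<in> unit_disc \<Longrightarrow> F z = exp (L (w z))"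
proof -
  obtain w where w: "w holomorphic_on unit_disc" "w ` unit_disc \<subseteq> unit_disc"
    "\<forall>z\<in>unit_disc. norm (w z) \<le> norm z" "\<forall>z\<in>unit_disc. F z = \<phi> (w z)"
    using assms unfolding subordinate_def by blast
  show ?thesis
  proof (rule that[of w])
    show "schwarz_function w" using w by (simp add: schwarz_function_def)
    show "F z = exp (L (w z))" if "z \<in> unit_disc" for z
      using w that phi by (metis image_subset_iff)
  qed
qed

text \<open>
  The values of \<open>exp \<circ> L\<close> are nonzero.  So \<open>p\<close> has no zero, hence \<open>g z / (z * p z)\<close> is analytic off
  the origin and nonzero there, hence \<open>g\<close> has no zero off the origin and the same applies to
  \<open>f z / g z\<close>.  No singularity other than the origin needs to be removed, and the three relations
  can be multiplied.
\<close>

lemma class_T_E: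
  assumes "f \<in> class_T \<phi>"
  obtains u v w where "schwarz_function u" "schwarz_function v" "schwarz_function w"
    "\<And>z. z \<in> unit_disc \<Longrightarrow> f z = z * exp (L (u z) + L (v z) + L (w z))"
proof -
  obtain g p where f: "f \<in> class_A" and g: "g \<in> class_A" and p: "p holomorphic_on unit_disc"
    and s1: "remove_sings (\<lambda>z. f z / g z) \<prec>\<^sub>s \<phi>"
    and s2: "remove_sings (\<lambda>z. g z / (z * p z)) \<prec>\<^sub>s \<phi>" and s3: "p \<prec>\<^sub>s \<phi>"
    using assms unfolding class_T_def by blast
  obtain u where u: "schwarz_function u"
    "\<And>z. z \<in> unit_disc \<Longrightarrow> remove_sings (\<lambda>z. f z / g z) z = exp (L (u z))"
    using subordinate_phiE[OF s1] by blast
  obtain v where v: "schwarz_function v"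
    "\<And>z. z \<in> unit_disc \<Longrightarrow> remove_sings (\<lambda>z. g z / (z * p z)) z = exp (L (v z))"
    using subordinate_phiE[OF s2] by blast
  obtain w where w: "schwarz_function w" "\<And>z. z \<in> unit_disc \<Longrightarrow> p z = exp (L (w z))"
    using subordinate_phiE[OF s3] by blast
  have an: "h analytic_on {z}" if "h holomorphic_on unit_disc" "z \<in> unit_disc" for h z
    using that analytic_on_open[of unit_disc h] analytic_on_subset[of h unit_disc "{z}"] by auto
  have fg: "f holomorphic_on unit_disc" "g holomorphic_on unit_disc"
    using f g by (auto simp: class_A_def)
  show ?thesis
  proof (rule that[OF u(1) v(1) w(1)])
    fix z assume z: "z \<in> unit_disc"
    show "f z = z * exp (L (u z) + L (v z) + L (w z))"
    proof (cases "z = 0")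
      case True
      then show ?thesis using f by (simp add: class_A_def)
    next
      case False
      have "(\<lambda>z. g z / (z * p z)) analytic_on {z}"
        by (intro analytic_intros an fg p z) (use False w(2)[OF z] in auto)
      then have g_eq: "g z = z * exp (L (v z)) * exp (L (w z))"
        using v(2)[OF z] False w(2)[OF z] by (simp add: field_simps)
      have "(\<lambda>z. f z / g z) analytic_on {z}"
        by (intro analytic_intros an fg z) (use False g_eq in auto)
      then show ?thesis
        using u(2)[OF z] False g_eq by (simp add: field_simps exp_add)
    qed
  qed
qed

definition extremal :: "complex \<Rightarrow> complex" where
  "extremal z = z * exp (3 * L z)"

text \<open>
  The witnesses are \<open>g z = z * exp (2 * L z)\<close> and \<open>p z = exp (L z)\<close>; each of the three quotients is
  then \<open>exp (L z)\<close> itself.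
\<close>

lemma extremal_in_class_T: "extremal \<in> class_T \<phi>"
proof -
  define g where "g = (\<lambda>z. z * exp (2 * L z))"
  have sub: "F \<prec>\<^sub>s \<phi>" if F: "\<And>z. z \<in> unit_disc \<Longrightarrow> F z = exp (L z)" for F
    unfolding subordinate_def
  proof (intro conjI exI[of _ "\<lambda>z. z"] hol_phi)
    show "F holomorphic_on unit_disc"
      by (rule holomorphic_transform[of "\<lambda>z. exp (L z)"]) (auto intro!: holomorphic_intros holL simp: F)
  qed (auto simp: F phi)
  have A: "extremal \<in> class_A" "g \<in> class_A"
    by (rule class_A_z_exp[of "\<lambda>z. 3 * L z"] class_A_z_exp[of "\<lambda>z. 2 * L z"];
        auto intro!: holomorphic_intros holL simp: L0 extremal_def g_def)+
  have e: "exp (3 * x) = exp (2 * x) * exp x" "exp (2 * x) = exp x * exp x" for x :: complex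
    by (simp_all flip: exp_add)
  have holE: "(\<lambda>z. exp (L z)) holomorphic_on unit_disc" by (intro holomorphic_intros holL)
  have 1: "remove_sings (\<lambda>z. extremal z / g z) z = exp (L z)" if "z \<in> unit_disc" for z
    by (rule remove_sings_eq_holomorphic[OF holE _ that])
       (auto simp: extremal_def g_def e(1))
  have 2: "remove_sings (\<lambda>z. g z / (z * exp (L z))) z = exp (L z)" if "z \<in> unit_disc" for z
    by (rule remove_sings_eq_holomorphic[OF holE _ that]) (auto simp: g_def e(2))
  show ?thesis
    unfolding class_T_def using A sub[OF 1] sub[OF 2] sub[of "\<lambda>z. exp (L z)"] holE by blast
qed

text \<open>
  The constant \<open>1/6\<close> is a third of \<open>1/2\<close>, the distance from 1 to the boundary of either target
  region.  The equation in \<open>sharp\<close> puts the quotient of the extremal function at \<open>- \<rho>\<close>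
  on that boundary, at the point \<open>1/2\<close>.
\<close>

lemma radius:
  assumes \<rho>: "0 < \<rho>" "\<rho> < 1"
    and bound: "\<And>w z. schwarz_function w \<Longrightarrow> norm z < \<rho> \<Longrightarrow>
                  norm (z * (deriv L (w z) * deriv w z)) < 1 / 6"
    and sharp: "of_real \<rho> * deriv L (- of_real \<rho>) = 1 / 6"
  shows "is_radius starlike_half (class_T \<phi>) \<rho>"
    and "is_radius parabolic_starlike (class_T \<phi>) \<rho>"
proof -
  have in_class: "F \<in> starlike_half \<and> F \<in> parabolic_starlike"
    if f: "f \<in> class_T \<phi>" and r: "0 < r" "r \<le> \<rho>"
      and F: "F = (\<lambda>z. f (of_real r * z) / of_real r)" for f F r
  proof -
    obtain u v w where uvw: "schwarz_function u" "schwarz_function v" "schwarz_function w"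
      and f_eq: "\<And>z. z \<in> unit_disc \<Longrightarrow> f z = z * exp (L (u z) + L (v z) + L (w z))"
      using class_T_E[OF f] by blast
    define k where "k = (\<lambda>z. L (u z) + L (v z) + L (w z))"
    have k: "k holomorphic_on unit_disc" "k 0 = 0"
      unfolding k_def using uvw
      by (auto intro!: holomorphic_intros L_comp(1) simp: schwarz_functionD(2) L0)
    have fk: "f z = z * exp (k z)" if "z \<in> unit_disc" for z
      using f_eq[OF that] by (simp add: k_def)
    have r1: "r \<le> 1" using r \<rho> by simp
    have near: "norm (starlike_quotient F z - 1) < 1 / 2" if z: "z \<in> unit_disc" for z
    proof -
      let ?x = "of_real r * z"
      have "norm ?x < r" using z r by (simp add: norm_mult)
      then have x: "norm ?x < \<rho>" "?x \<in> unit_disc" using r \<rho> by auto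
      have "(k has_field_derivative deriv L (u ?x) * deriv u ?x + deriv L (v ?x) * deriv v ?x
          + deriv L (w ?x) * deriv w ?x) (at ?x)"
        unfolding k_def by (intro DERIV_add L_comp(2) uvw x)
      note dk = DERIV_imp_deriv[OF this]
      have "starlike_quotient F z = 1 + ?x * deriv k ?x"
        unfolding F by (rule dilation_z_exp(2)[OF k r(1) r1 fk z])
      then have "starlike_quotient F z - 1 = ?x * (deriv L (u ?x) * deriv u ?x)
          + ?x * (deriv L (v ?x) * deriv v ?x) + ?x * (deriv L (w ?x) * deriv w ?x)"
        unfolding dk by (simp add: algebra_simps)
      then have "norm (starlike_quotient F z - 1) \<le> norm (?x * (deriv L (u ?x) * deriv u ?x))
          + norm (?x * (deriv L (v ?x) * deriv v ?x)) + norm (?x * (deriv L (w ?x) * deriv w ?x))"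
        by (metis norm_triangle_mono norm_triangle_ineq order_refl)
      also have "\<dots> < 1 / 6 + 1 / 6 + 1 / 6" by (intro add_strict_mono bound uvw x)
      finally show ?thesis by simp
    qed
    have half: "Re (starlike_quotient F z) > 1 / 2" if "z \<in> unit_disc" for z
      using near[OF that] abs_Re_le_cmod[of "starlike_quotient F z - 1"] by simp
    have "F \<in> class_A" unfolding F by (rule dilation_z_exp(1)[OF k r(1) r1 fk])
    then show ?thesis
      using near half unfolding starlike_half_def parabolic_starlike_def by force
  qed
  have not_in: "F \<notin> starlike_half \<and> F \<notin> parabolic_starlike"
    if R: "\<rho> < R" "R \<le> 1" and F: "F = (\<lambda>z. extremal (of_real R * z) / of_real R)" for R F
  proof -
    have k: "(\<lambda>z. 3 * L z) holomorphic_on unit_disc" "3 * L 0 = 0"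
      by (auto intro!: holomorphic_intros holL simp: L0)
    have R0: "0 < R" using R \<rho> by simp
    \<comment> \<open>The point that the dilation by \<open>R\<close> sends to \<open>- \<rho>\<close>; it is in the disc because \<open>R > \<rho>\<close>.\<close>
    define z :: complex where "z = - of_real (\<rho> / R)"
    have z: "z \<in> unit_disc" and Rz: "of_real R * z = - of_real \<rho>"
      using R \<rho> by (auto simp: z_def norm_divide)
    have "L field_differentiable at (- of_real \<rho>)"
      using holL \<rho> by (intro holomorphic_on_imp_differentiable_at[of _ unit_disc]) auto
    then have "deriv (\<lambda>z. 3 * L z) (- of_real \<rho>) = 3 * deriv L (- of_real \<rho>)"
      by (rule deriv_cmult)
    moreover have "starlike_quotient F z
        = 1 + of_real R * z * deriv (\<lambda>z. 3 * L z) (of_real R * z)"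
      unfolding F by (rule dilation_z_exp(2)[OF k R0 R(2) extremal_def z])
    ultimately have "starlike_quotient F z = 1 - 3 * (of_real \<rho> * deriv L (- of_real \<rho>))"
      unfolding Rz by simp
    also have "\<dots> = 1 / 2" by (simp only: sharp) simp
    finally have q: "starlike_quotient F z = 1 / 2" .
    have "Re (starlike_quotient F z) = 1 / 2" "norm (starlike_quotient F z - 1) = 1 / 2"
      unfolding q by (simp_all add: norm_divide)
    then show ?thesis using z unfolding starlike_half_def parabolic_starlike_def by force
  qed
  have "is_radius G (class_T \<phi>) \<rho>" if G: "G = starlike_half \<or> G = parabolic_starlike" for G
    unfolding is_radius_def
  proof (intro conjI allI impI)
    show "admissible_radius G (class_T \<phi>) \<rho>"
      unfolding admissible_radius_def using \<rho> in_class G by auto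
    show "R \<le> \<rho>" if "admissible_radius G (class_T \<phi>) R" for R
    proof (rule ccontr)
      assume "\<not> R \<le> \<rho>"
      then show False
        using that extremal_in_class_T not_in[OF _ _ refl, of R] \<rho> G
        unfolding admissible_radius_def by force
    qed
  qed
  then show "is_radius starlike_half (class_T \<phi>) \<rho>" "is_radius parabolic_starlike (class_T \<phi>) \<rho>"
    by auto
qed

end

section \<open>The square root and the exponential\<close>

lemma radius_T1:
  shows "is_radius starlike_half T1 (1 / 4)" and "is_radius parabolic_starlike T1 (1 / 4)"
proof -
  let ?L = "\<lambda>z::complex. Ln (1 + z) / 2"
  have slit: "1 + z \<notin> \<real>\<^sub>\<le>\<^sub>0" if "z \<in> unit_disc" for z :: complex
  proof
    assume "1 + z \<in> \<real>\<^sub>\<le>\<^sub>0"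
    then show False
      using that abs_Re_le_cmod[of z] by (auto simp: complex_nonpos_Reals_iff)
  qed
  have ne: "1 + z \<noteq> 0" if "z \<in> unit_disc" for z :: complex
    using slit[OF that] by auto
  interpret exponential_generator "\<lambda>z. csqrt (1 + z)" ?L
    by unfold_locales (auto intro!: holomorphic_intros csqrt_exp_Ln slit ne)
  have dL: "deriv ?L z = inverse (1 + z) / 2" if "z \<in> unit_disc" for z
    by (rule DERIV_imp_deriv) (rule derivative_eq_intros refl slit that | simp)+
  have bound: "norm (z * (deriv ?L (w z) * deriv w z)) < 1 / 6"
    if w: "schwarz_function w" and z: "norm z < 1 / 4" for w z
  proof -
    have "w z \<in> unit_disc" using schwarz_functionD(4)[OF w, of z] z by simp
    then have "deriv ?L (w z) = inverse (1 + w z) / 2" by (rule dL)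
    then have "z * (deriv ?L (w z) * deriv w z) = z * deriv w z / (1 + w z) / 2"
      by (simp only: divide_inverse mult_ac)
    then have "norm (z * (deriv ?L (w z) * deriv w z)) = norm (z * deriv w z / (1 + w z)) / 2"
      by (simp only: norm_divide norm_numeral)
    also have "\<dots> \<le> norm z / (1 - norm z) / 2"
      by (intro divide_right_mono schwarz_function_log_deriv_le[OF w]) (use z in auto)
    also have "\<dots> < 1 / 6" using z by (simp add: field_simps)
    finally show ?thesis .
  qed
  have sharp: "of_real (1 / 4) * deriv ?L (- of_real (1 / 4)) = 1 / 6"
    by (subst dL) auto
  show "is_radius starlike_half T1 (1 / 4)" "is_radius parabolic_starlike T1 (1 / 4)"
    unfolding T1_def by (rule radius[OF _ _ bound sharp]; simp)+
qed

lemma radius_T2: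
  shows "is_radius starlike_half T2 (1 / 6)" and "is_radius parabolic_starlike T2 (1 / 6)"
proof -
  interpret exponential_generator exp "\<lambda>z. z"
    by unfold_locales auto
  have bound: "norm (z * (deriv (\<lambda>z. z) (w z) * deriv w z)) < 1 / 6"
    if w: "schwarz_function w" and z: "norm z < 1 / 6" for w z
  proof -
    have "(norm z)\<^sup>2 \<le> (1 / 6)\<^sup>2" using z by (intro power_mono) auto
    then have "norm (z * deriv w z) \<le> norm z"
      using z by (intro schwarz_function_deriv_le w) (auto simp: power2_eq_square)
    then show ?thesis using z by simp
  qed
  show "is_radius starlike_half T2 (1 / 6)" "is_radius parabolic_starlike T2 (1 / 6)"
    unfolding T2_def by (rule radius[OF _ _ bound]; simp)+
qed

theorem corollary2p3:
  shows "(\<exists>R. is_radius parabolic_starlike T1 R \<and> is_radius starlike_half T1 R) \<and>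
         (\<exists>R. is_radius parabolic_starlike T2 R \<and> is_radius starlike_half T2 R) \<and>
         is_radius parabolic_starlike T1 (1 / 4) \<and>
         is_radius parabolic_starlike T2 (1 / 6)"
  using radius_T1 radius_T2 by blast

end
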